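(* Let $\bar B(\sigma),\bar K(\sigma)\in\mathbb{R}^{s\times s}$ be the coefficients of an LSRK Peer method satisfying the order conditions $$V_r=\bar B(\sigma)V_r\mathcal{P}_r^{-1}S(\sigma)^{-1}+\bar K(\sigma)V_r\tilde E_r$$ with $r\ge2$, and let $W\in\mathbb{R}^{s\times s}$ be a nonsingular matrix such that for every $\sigma\in\mathcal{S}$ the matrix $M=W^{-1}\bar B(\sigma)W$ is in the block form $$M=\begin{pmatrix}1&0^{T}\\0&M_{se}\end{pmatrix},\qquad \|M_{se}\|_2<1.$$ Choose $\nu\ge0$ with $\nu<\min\{1,\nu_\infty\}$, where $\nu_\infty:=1/\max\{|||\bar K(\sigma)^{-1}\bar B(\sigma)|||:\sigma\in\mathcal{S}\}$, and choose $\eta>0$. With $\Gamma=W^{-1}\bar K(\sigma)W$ let $$\Omega(\xi)=I-MM^{T}+2\xi(\Gamma_S+\mathbf{i}\eta\,\Gamma_A-\nu MM^{T})+\xi^2(1+\eta^2)\big(\Gamma\Gamma^{T}-\nu^2MM^{T}\big),$$ compute its formal LU-decomposition $\Omega(\xi)=L(\xi)U(\xi)$ and let $\zeta_i(\xi)=\xi^{-1}u_{11}(\xi)\cdots u_{ii}(\xi)$, $i=1,\ldots,s$. If, for every $\sigma\in\mathcal{S}$, this decomposition exists, the polynomials $\zeta_i(\xi)$ are nontrivial for $i=1,\ldots,s$, and there exist $\ell_i\in\mathbb{N}_0$ such that $(1+\xi)^{\ell_i}\zeta_i(\xi)$ possesses no negative coefficients, then $\Omega(\xi)$ is positive definite for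 $\xi>0$ and $$|||(I-z\bar K(\sigma))^{-1}\bar B(\sigma)|||\le\frac1{|1-\nu z|}\qquad\text{for all } z\in\mathbb{C},\ |\mathrm{Im}\,z|\le-\eta\,\mathrm{Re}\,z,\ \sigma\in\mathcal{S}.$$
   Context: $\mathcal{S}\subseteq(0,2)$ is the set of admissible stepsize ratios (an interval $[\underline\sigma,\bar\sigma]$ or a finite set). The method has pairwise distinct nodes $c_1,\dots,c_s$; $\mathbf{c}^j=(c_1^j,\ldots,c_s^j)^{T}$, $\mathbf{1}=(1,\ldots,1)^{T}$, $V_r=(\mathbf{1},\mathbf{c},\ldots,\mathbf{c}^{r-1})$, $\mathcal{P}_r=\big(\binom{j-1}{i-1}\big)_{i,j=1}^r$, $\tilde E_r=(i\,\delta_{i+1,j})_{i,j=1}^r$, $S(\sigma)=\mathrm{diag}(1,\sigma,\ldots,\sigma^{r-1})$. A Peer method for $y'=f(y)$ reads $Y_n=\bar B(\sigma_n)Y_{n-1}+h_n\bar K(\sigma_n)F(Y_n)$ with $\sigma_n=h_n/h_{n-1}$ and $F(Y_n)=(f(Y_{ni}))_{i=1}^s$; $\bar K(\sigma)$ is lower triangular with positive diagonal entries (so it is nonsingular with positive real eigenvalues). LSRK (Last Stage is Runge-Kutta) means $c_s=1$ and $e_s^{T}\bar B(\sigma)=e_s^{T}$ for all $\sigma$. Norm: $|||\Theta|||:=\|W^{-1}\Theta W\|_2$ for $\Theta\in\mathbb{C}^{s\times s}$, with $\|\cdot\|_2$ the spectral norm. $\Gamma_S=\frac12(\Gamma+\Gamma^{T})$,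 $\Gamma_A=\frac12(\Gamma-\Gamma^{T})$, $\mathbf{i}$ is the imaginary unit. $M,\Gamma,\Omega,L,U,\zeta_i,\ell_i$ depend on $\sigma\in\mathcal{S}$. In the formal LU-decomposition (over rational functions of $\xi$), $L$ is unit lower triangular and $U=(u_{ij})$ is upper triangular, so $\xi\zeta_i(\xi)$ is the $i$-th leading principal minor of $\Omega(\xi)$. *)

theory Defs
  imports
    "HOL-Analysis.L2_Norm"
    "HOL-Library.Extended_Real"
    "Jordan_Normal_Form.Gauss_Jordan_Elimination"
    "Jordan_Normal_Form.Determinant"
begin

(* Matrices are those of Jordan_Normal_Form.Matrix, so all indices are shifted to start
   at 0: node c_i is c (i - 1), and the last stage has index s - 1. *)

section \<open>Matrices and norms\<close>

abbreviation cmat :: "real mat \<Rightarrow> complex mat" where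
  "cmat \<equiv> map_mat complex_of_real"

(* Unspecified on singular matrices; it is only applied to matrices that the hypotheses of
   the theorem make nonsingular. *)
definition minv :: "'a::field mat \<Rightarrow> 'a mat" where
  "minv A = the (mat_inverse A)"

definition vnorm2 :: "complex vec \<Rightarrow> real" where
  "vnorm2 v = L2_set (\<lambda>i. cmod (vec_index v i)) {..<dim_vec v}"

(* The closed unit ball rather than the unit sphere, so that the 0 x 0 matrix (the block
   M_se for s = 1) has norm 0. *)
definition spectral_norm :: "complex mat \<Rightarrow> real" where
  "spectral_norm A = (SUP v \<in> {v \<in> carrier_vec (dim_col A). vnorm2 v \<le> 1}. vnorm2 (A *\<^sub>v v))"

definition weighted_norm :: "real mat \<Rightarrow> complex mat \<Rightarrow> real" where
  "weighted_norm W A = spectral_norm (minv (cmat W) * A * cmat W)"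

definition conj_by :: "real mat \<Rightarrow> real mat \<Rightarrow> real mat" where
  "conj_by W A = minv W * A * W"

definition positive_definite :: "complex mat \<Rightarrow> bool" where
  "positive_definite A \<longleftrightarrow> square_mat A \<and>
     (\<forall>i < dim_row A. \<forall>j < dim_row A. A $$ (i,j) = cnj (A $$ (j,i))) \<and>
     (\<forall>v \<in> carrier_vec (dim_row A). v \<noteq> 0\<^sub>v (dim_row A) \<longrightarrow> Re ((A *\<^sub>v v) \<bullet>c v) > 0)"

section \<open>Peer methods\<close>

(* Coefficients of Y_n = B(sigma_n) Y_(n-1) + h_n K(sigma_n) F(Y_n), sigma_n = h_n / h_(n-1). *)
definition peer_coefficients ::
  "nat \<Rightarrow> real set \<Rightarrow> (nat \<Rightarrow> real) \<Rightarrow> (real \<Rightarrow> real mat) \<Rightarrow> (real \<Rightarrow> real mat) \<Rightarrow> bool" where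
  "peer_coefficients s S c B K \<longleftrightarrow> inj_on c {..<s} \<and>
     (\<forall>\<sigma> \<in> S. B \<sigma> \<in> carrier_mat s s \<and> K \<sigma> \<in> carrier_mat s s \<and>
        (\<forall>i < s. K \<sigma> $$ (i,i) > 0) \<and> (\<forall>i < s. \<forall>j < s. i < j \<longrightarrow> K \<sigma> $$ (i,j) = 0))"

definition LSRK :: "nat \<Rightarrow> real set \<Rightarrow> (nat \<Rightarrow> real) \<Rightarrow> (real \<Rightarrow> real mat) \<Rightarrow> bool" where
  "LSRK s S c B \<longleftrightarrow> c (s - 1) = 1 \<and> (\<forall>\<sigma> \<in> S. row (B \<sigma>) (s - 1) = unit_vec s (s - 1))"

definition vander :: "nat \<Rightarrow> nat \<Rightarrow> (nat \<Rightarrow> real) \<Rightarrow> real mat" where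
  "vander s r c = mat s r (\<lambda>(i,j). c i ^ j)"

definition pascal :: "nat \<Rightarrow> real mat" where
  "pascal r = mat r r (\<lambda>(i,j). of_nat (j choose i))"

definition E_tilde :: "nat \<Rightarrow> real mat" where
  "E_tilde r = mat r r (\<lambda>(i,j). if j = i + 1 then of_nat (i + 1) else 0)"

definition S_diag :: "nat \<Rightarrow> real \<Rightarrow> real mat" where
  "S_diag r \<sigma> = mat_diag r (\<lambda>i. \<sigma> ^ i)"

definition order_conditions ::
  "nat \<Rightarrow> nat \<Rightarrow> (nat \<Rightarrow> real) \<Rightarrow> real \<Rightarrow> real mat \<Rightarrow> real mat \<Rightarrow> bool" where
  "order_conditions s r c \<sigma> B K \<longleftrightarrow>
     vander s r c =
       B * vander s r c * minv (pascal r) * minv (S_diag r \<sigma>) + K * vander s r c * E_tilde r"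

section \<open>Stability on the sector\<close>

(* The supremum is taken in ereal: it is the maximum over S whenever that is attained, and
   no extra assumption about attainment or boundedness is needed for it to be meaningful. *)
definition nu_infinity ::
  "real mat \<Rightarrow> real set \<Rightarrow> (real \<Rightarrow> real mat) \<Rightarrow> (real \<Rightarrow> real mat) \<Rightarrow> ereal" where
  "nu_infinity W S B K =
     1 / (SUP \<sigma> \<in> S. ereal (weighted_norm W (cmat (minv (K \<sigma>) * B \<sigma>))))"

definition sym_part :: "real mat \<Rightarrow> real mat" where
  "sym_part A = (1/2) \<cdot>\<^sub>m (A + transpose_mat A)"

definition skew_part :: "real mat \<Rightarrow> real mat" where
  "skew_part A = (1/2) \<cdot>\<^sub>m (A - transpose_mat A)"

(* Omega as a matrix of polynomials in the indeterminate xi. *)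
definition Omega_poly :: "real \<Rightarrow> real \<Rightarrow> real mat \<Rightarrow> real mat \<Rightarrow> complex poly mat" where
  "Omega_poly \<nu> \<eta> M \<Gamma> =
     (let MM = M * transpose_mat M;
          C0 = cmat (1\<^sub>m (dim_row M) - MM);
          C1 = 2 \<cdot>\<^sub>m (cmat (sym_part \<Gamma>) + (\<i> * of_real \<eta>) \<cdot>\<^sub>m cmat (skew_part \<Gamma>) - cmat (\<nu> \<cdot>\<^sub>m MM));
          C2 = cmat ((1 + \<eta>\<^sup>2) \<cdot>\<^sub>m (\<Gamma> * transpose_mat \<Gamma> - \<nu>\<^sup>2 \<cdot>\<^sub>m MM))
      in map_mat (\<lambda>a. monom a 0) C0 + map_mat (\<lambda>a. monom a 1) C1 + map_mat (\<lambda>a. monom a 2) C2)"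

definition Omega_at :: "real \<Rightarrow> real \<Rightarrow> real mat \<Rightarrow> real mat \<Rightarrow> real \<Rightarrow> complex mat" where
  "Omega_at \<nu> \<eta> M \<Gamma> \<xi> = map_mat (\<lambda>p. poly p (of_real \<xi>)) (Omega_poly \<nu> \<eta> M \<Gamma>)"

definition formal_LU ::
  "complex poly mat \<Rightarrow> complex poly fract mat \<Rightarrow> complex poly fract mat \<Rightarrow> bool" where
  "formal_LU A L U \<longleftrightarrow>
     (let n = dim_row A in
        L \<in> carrier_mat n n \<and> U \<in> carrier_mat n n \<and>
        (\<forall>i < n. L $$ (i,i) = 1) \<and> (\<forall>i < n. \<forall>j < n. i < j \<longrightarrow> L $$ (i,j) = 0) \<and>
        upper_triangular U \<and> map_mat to_fract A = L * U)"

definition zeta :: "complex poly fract mat \<Rightarrow> nat \<Rightarrow> complex poly fract" where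
  "zeta U i = (\<Prod>j\<le>i. U $$ (j,j)) / to_fract [:0, 1:]"

(* The order on complex is that of Complex_Order: 0 \<le> a says that a is real and nonnegative. *)
definition no_negative_coeffs :: "complex poly fract \<Rightarrow> bool" where
  "no_negative_coeffs f \<longleftrightarrow> (\<exists>q. f = to_fract q \<and> (\<forall>k. 0 \<le> coeff q k))"

end

theory Submission
  imports "HOL-Complex_Analysis.Conformal_Mappings" Defs
begin

text \<open>
  Write \<open>T(z) = (I - z \<Gamma>)\<^sup>-\<^sup>1 M\<close> for the matrix whose spectral norm is to be bounded; it is the
  conjugate by \<open>W\<close> of \<open>(I - z K)\<^sup>-\<^sup>1 B\<close>. With \<open>N = I - z \<Gamma>\<close> the bound \<open>\<bar>1 - \<nu> z\<bar> \<parallel>T(z)\<parallel> \<le> 1\<close> says that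
  \<open>N N\<^sup>* - \<bar>1 - \<nu> z\<bar>\<^sup>2 M M\<^sup>*\<close> is positive semidefinite, and on the ray \<open>z = - \<xi> (1 + \<i> \<eta>)\<close> this
  difference is exactly \<open>\<Omega>(\<xi>)\<close> (\<open>Omega_at_eq_difference\<close>).

  Positive definiteness of \<open>\<Omega>(\<xi>)\<close> comes from Sylvester's criterion (\<open>sylvester_criterion\<close>). The
  product \<open>u\<^sub>1\<^sub>1 \<cdots> u\<^sub>i\<^sub>i = \<xi> \<zeta>\<^sub>i(\<xi>)\<close> is the \<open>i\<close>-th leading minor of \<open>\<Omega>\<close>, and a nonzero
  polynomial with nonnegative coefficients is positive for \<open>\<xi> > 0\<close>; the factor \<open>(1 + \<xi>)\<^sup>\<ell>\<close> is
  positive there and can be divided out (\<open>leading_minor_pos\<close>).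

  This gives the norm bound on the lower boundary ray of the sector and, since \<open>M\<close> and \<open>\<Gamma>\<close> are real,
  also on the upper one. In the interior of the sector the difference of Gram matrices is no longer a
  value of \<open>\<Omega>\<close>, and the bound is obtained from the maximum principle. For fixed
  vectors \<open>v\<close> and \<open>u\<close> the function \<open>(1 - \<nu> z) \<langle>T(z) v, u\<rangle>\<close> is rational; its poles lie among the points
  \<open>1 / K\<^sub>i\<^sub>i > 0\<close> because \<open>K\<close> is triangular with positive diagonal, and it has a limit at infinity
  because the resolvent decays like \<open>1 / z\<close> (\<open>resolvent_form_holomorphic\<close>). The bounds at the vertex
  and at infinity are limits of the bound along a boundary ray, so the maximum modulus theorem on
  the truncated sector applies (\<open>sector_maximum_modulus\<close>).
\<close>

(* The subscript and dot symbols denote the operations on vectors with explicit dimension. *)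
unbundle no vec_syntax
no_notation inner (infix "\<bullet>" 70)

section \<open>Vectors, norms and inverses\<close>

abbreviation adjoint_mat :: "complex mat \<Rightarrow> complex mat" where
  "adjoint_mat A \<equiv> map_mat cnj (transpose_mat A)"

lemma cscalar_prod_mult_mat_vec:
  assumes "A \<in> carrier_mat m n" "v \<in> carrier_vec n" "w \<in> carrier_vec m"
  shows "(A *\<^sub>v v) \<bullet>c w = v \<bullet>c (adjoint_mat A *\<^sub>v w)"
proof -
  have "(A *\<^sub>v v) \<bullet>c w = (\<Sum>i<m. \<Sum>j<n. A $$ (i,j) * v $ j * cnj (w $ i))"
    using assms by (auto simp: scalar_prod_def lessThan_atLeast0 sum_distrib_right intro!: sum.cong)
  also have "\<dots> = (\<Sum>j<n. \<Sum>i<m. A $$ (i,j) * v $ j * cnj (w $ i))"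
    by (rule sum.swap)
  also have "\<dots> = v \<bullet>c (adjoint_mat A *\<^sub>v w)"
    using assms
    by (auto simp: scalar_prod_def lessThan_atLeast0 sum_distrib_left mult_ac intro!: sum.cong)
  finally show ?thesis .
qed

lemma adjoint_mat_mult:
  assumes "X \<in> carrier_mat n m" "Y \<in> carrier_mat m k"
  shows "adjoint_mat (X * Y) = adjoint_mat Y * adjoint_mat X"
  using assms by (intro eq_matI) (auto simp: scalar_prod_def mult.commute intro!: sum.cong)

lemma vnorm2_sq_complex: "complex_of_real ((vnorm2 v)\<^sup>2) = v \<bullet>c v"
  by (simp add: vnorm2_def L2_set_def sum_nonneg scalar_prod_def lessThan_atLeast0
      flip: complex_norm_square)

lemma vnorm2_nonneg: "0 \<le> vnorm2 v"
  by (simp add: vnorm2_def L2_set_def sum_nonneg)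

lemma cmod_cscalar_prod_le:
  assumes "dim_vec v = dim_vec w"
  shows "cmod (v \<bullet>c w) \<le> vnorm2 v * vnorm2 w"
proof -
  have "cmod (v \<bullet>c w) \<le> (\<Sum>i<dim_vec w. cmod (v $ i) * cmod (w $ i))"
    using assms by (auto simp: scalar_prod_def lessThan_atLeast0 norm_mult intro!: sum_norm_le)
  also have "\<dots> \<le> vnorm2 v * vnorm2 w"
    using L2_set_mult_ineq[of "\<lambda>i. cmod (v $ i)" "\<lambda>i. cmod (w $ i)" "{..<dim_vec w}"] assms
    by (simp add: vnorm2_def)
  finally show ?thesis .
qed

lemma vnorm2_conjugate: "vnorm2 (conjugate v) = vnorm2 v"
  by (auto simp: vnorm2_def intro!: L2_set_cong)

lemma minv_right_left:
  fixes A :: "'a::field mat"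
  assumes A: "A \<in> carrier_mat n n" and det: "Determinant.det A \<noteq> 0"
  shows "minv A \<in> carrier_mat n n" "A * minv A = 1\<^sub>m n" "minv A * A = 1\<^sub>m n"
proof -
  have "A \<in> Units (ring_mat TYPE('a) n ())"
    using det_non_zero_imp_unit[OF A det] .
  then obtain A' where "mat_inverse A = Some A'"
    using mat_inverse(1)[OF A] by fastforce
  then show "minv A \<in> carrier_mat n n" "A * minv A = 1\<^sub>m n" "minv A * A = 1\<^sub>m n"
    using mat_inverse(2)[OF A] by (auto simp: minv_def)
qed

lemma det_nonzero_if_invertible_mat:
  fixes A :: "'a::field mat"
  assumes A: "A \<in> carrier_mat n n" and inv: "invertible_mat A"
  shows "Determinant.det A \<noteq> 0"
proof -
  obtain A' where A': "A * A' = 1\<^sub>m n" "A' * A = 1\<^sub>m (dim_row A')"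
    using inv A unfolding invertible_mat_def inverts_mat_def by auto
  have c: "A' \<in> carrier_mat n n"
    using arg_cong[OF A'(1), of dim_col] arg_cong[OF A'(2), of dim_col] A
    by auto
  have "Determinant.det A * Determinant.det A' = 1"
    using det_mult[OF A c] A' by simp
  then show ?thesis by auto
qed

lemma minv_cmat:
  assumes A: "A \<in> carrier_mat n n" and det: "Determinant.det A \<noteq> 0"
  shows "minv (cmat A) = cmat (minv A)"
proof -
  note m = minv_right_left[OF A det]
  have "Determinant.det (cmat A) \<noteq> 0"
    using det by (simp add: of_real_hom.hom_det)
  then have mc: "minv (cmat A) \<in> carrier_mat n n" "minv (cmat A) * cmat A = 1\<^sub>m n"
    using A by (auto intro!: minv_right_left[of "cmat A" n])
  have "cmat A * cmat (minv A) = 1\<^sub>m n"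
    using m A by (metis of_real_hom.mat_hom_mult of_real_hom.mat_hom_one)
  then have "minv (cmat A) = minv (cmat A) * (cmat A * cmat (minv A))"
    using mc by simp
  also have "\<dots> = (minv (cmat A) * cmat A) * cmat (minv A)"
    using mc m A by (subst assoc_mult_mat[of _ n n _ n _ n]) auto
  finally show ?thesis using mc m by simp
qed

section \<open>Leading minors and positive definiteness\<close>

text \<open>Induction on the size. A Schur complement argument would call for the inverse of the leading block;
  the last column of the adjugate of the matrix serves instead, since the matrix maps it to a
  multiple of the last unit vector. Entries are given as a function, so that all leading blocks are
  restrictions of the same data.\<close>

lemma sylvester_criterion:
  fixes a :: "nat \<Rightarrow> nat \<Rightarrow> complex"
  assumes herm: "\<And>i j. i < n \<Longrightarrow> j < n \<Longrightarrow> a i j = cnj (a j i)"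
    and minors: "\<And>k. k \<le> n \<Longrightarrow> 0 < Determinant.det (mat k k (\<lambda>(i,j). a i j))"
    and v: "\<exists>i<n. v i \<noteq> 0"
  shows "0 < Re (\<Sum>i<n. \<Sum>j<n. cnj (v i) * a i j * v j)"
  using assms
proof (induction n arbitrary: v)
  case 0
  then show ?case by simp
next
  case (Suc n)
  let ?A = "mat (Suc n) (Suc n) (\<lambda>(i,j). a i j)"
  \<comment> \<open>The last column of the adjugate satisfies \<open>A x = (det A) e\<^sub>n\<close>, and its last entry is the
    previous leading minor. So \<open>x\<close> is orthogonal, for the form of \<open>A\<close>, to every vector with
    vanishing last entry.\<close>
  define x where "x i = adj_mat ?A $$ (i, n)" for i
  obtain d' where d': "d' > 0" "Determinant.det (mat n n (\<lambda>(i,j). a i j)) = complex_of_real d'"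
    using Suc.prems(2)[of n] by (metis le_SucI less_complex_def order.refl zero_complex.sel of_real_Re complex_is_Real_iff)
  obtain d where d: "d > 0" "Determinant.det ?A = complex_of_real d"
    using Suc.prems(2)[of "Suc n"] by (metis less_complex_def order.refl zero_complex.sel of_real_Re complex_is_Real_iff)
  have "mat_delete ?A n n = mat n n (\<lambda>(i,j). a i j)"
    by (auto simp: mat_delete_def)
  then have xn: "x n = of_real d'"
    using d' by (simp add: x_def adj_mat_def cofactor_def)
  have Ax: "(\<Sum>j<Suc n. a i j * x j) = (if i = n then of_real d else 0)" if "i < Suc n" for i
  proof -
    have "(\<Sum>j<Suc n. a i j * x j) = (?A * adj_mat ?A) $$ (i, n)"
      using that adj_mat(1)[of ?A "Suc n"]
      by (auto simp: x_def scalar_prod_def lessThan_atLeast0 simp del: sum.op_ivl_Suc intro!: sum.cong)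
    also have "\<dots> = (Determinant.det ?A \<cdot>\<^sub>m 1\<^sub>m (Suc n)) $$ (i, n)"
      by (subst adj_mat(2)) auto
    finally show ?thesis using that d by simp
  qed
  \<comment> \<open>\<open>v = w + t x\<close> with \<open>w n = 0\<close>, hence \<open>Q(v) = Q(w) + \<bar>t\<bar>\<^sup>2 Q(x)\<close>, where \<open>Q(x) = d d'\<close>.\<close>
  define t where "t = v n / of_real d'"
  define w where "w i = v i - t * x i" for i
  have wn: "w n = 0" using d' by (simp add: w_def t_def xn)
  have av: "(\<Sum>j<Suc n. a i j * v j) = (\<Sum>j<Suc n. a i j * w j) + (if i = n then t * of_real d else 0)"
    if "i < Suc n" for i
  proof -
    have "(\<Sum>j<Suc n. a i j * v j) = (\<Sum>j<Suc n. a i j * w j + t * (a i j * x j))"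
      by (intro sum.cong) (auto simp: w_def algebra_simps)
    also have "\<dots> = (\<Sum>j<Suc n. a i j * w j) + t * (\<Sum>j<Suc n. a i j * x j)"
      by (simp only: sum.distrib sum_distrib_left)
    finally show ?thesis using Ax[OF that] by auto
  qed
  have herm': "cnj (a j i) = a i j" if "i < Suc n" "j < Suc n" for i j
    using Suc.prems(1)[OF that] by simp
  let ?Q = "\<lambda>m u. \<Sum>i<m. \<Sum>j<m. cnj (u i) * a i j * u j"
  have "?Q (Suc n) v = (\<Sum>i<Suc n. cnj (v i) * (\<Sum>j<Suc n. a i j * v j))"
    by (simp only: sum_distrib_left mult.assoc)
  also have "\<dots> = (\<Sum>i<Suc n. cnj (v i) * (\<Sum>j<Suc n. a i j * w j)
       + (if i = n then cnj (v n) * (t * of_real d) else 0))"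
    by (intro sum.cong refl) (subst av, auto simp: algebra_simps)
  also have "\<dots> = (\<Sum>i<Suc n. cnj (v i) * (\<Sum>j<Suc n. a i j * w j)) + cnj (v n) * (t * of_real d)"
    by (simp only: sum.distrib) simp
  also have "(\<Sum>i<Suc n. cnj (v i) * (\<Sum>j<Suc n. a i j * w j))
      = (\<Sum>j<Suc n. \<Sum>i<Suc n. cnj (v i) * a i j * w j)"
    unfolding sum_distrib_left by (subst sum.swap) (simp only: mult.assoc)
  also have "\<dots> = (\<Sum>j<Suc n. cnj (\<Sum>i<Suc n. a j i * v i) * w j)"
    unfolding cnj_sum sum_distrib_right
    by (intro sum.cong refl) (simp add: herm' mult_ac)
  also have "\<dots> = (\<Sum>j<Suc n. cnj (\<Sum>i<Suc n. a j i * w i) * w j)"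
    by (intro sum.cong refl) (subst av, auto simp: wn)
  also have "\<dots> = (\<Sum>j<Suc n. \<Sum>i<Suc n. cnj (w i) * a i j * w j)"
    unfolding cnj_sum sum_distrib_right
    by (intro sum.cong refl) (simp add: herm' mult_ac)
  also have "\<dots> = ?Q n w"
    by (subst sum.swap) (simp add: wn)
  also have "cnj (v n) * (t * of_real d) = of_real ((cmod (v n))\<^sup>2 * d / d')"
    unfolding of_real_mult of_real_divide complex_norm_square t_def by simp
  finally have "?Q (Suc n) v = ?Q n w + of_real ((cmod (v n))\<^sup>2 * d / d')" .
  then have Q: "Re (?Q (Suc n) v) = Re (?Q n w) + (cmod (v n))\<^sup>2 * d / d'"
    by (simp only: plus_complex.sel Re_complex_of_real)
  have IH: "0 < Re (?Q n w)" if "\<exists>i<n. w i \<noteq> 0"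
  proof (rule Suc.IH)
    show "a i j = cnj (a j i)" if "i < n" "j < n" for i j
      using that by (intro Suc.prems(1)) auto
    show "0 < Determinant.det (mat k k (\<lambda>(i,j). a i j))" if "k \<le> n" for k
      using that by (intro Suc.prems(2)) auto
  qed (rule that)
  show ?case
  proof (cases "v n = 0")
    case True
    then have "w = v" by (auto simp: w_def t_def)
    then have "\<exists>i<n. w i \<noteq> 0" using Suc.prems(3) True less_Suc_eq by auto
    then show ?thesis using IH Q True by simp
  next
    case False
    have "0 \<le> Re (?Q n w)"
    proof (cases "\<exists>i<n. w i \<noteq> 0")
      case True
      then show ?thesis using IH by simp
    next
      case False
      then have "?Q n w = 0" by (intro sum.neutral ballI) auto
      then show ?thesis by simp
    qed
    moreover have "0 < (cmod (v n))\<^sup>2 * d / d'"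
      using False d d' by simp
    ultimately show ?thesis using Q by simp
  qed
qed

lemma positive_definite_sylvester:
  assumes A: "A \<in> carrier_mat n n" 
    and herm: "\<And>i j. i < n \<Longrightarrow> j < n \<Longrightarrow> A $$ (i,j) = cnj (A $$ (j,i))"
    and minors: "\<And>k. k < n \<Longrightarrow> 0 < Determinant.det (mat (Suc k) (Suc k) (\<lambda>(i,j). A $$ (i,j)))"
  shows "positive_definite A"
  unfolding positive_definite_def
proof (intro conjI ballI impI allI)
  show "square_mat A" using A by auto
  show "A $$ (i,j) = cnj (A $$ (j,i))" if "i < dim_row A" "j < dim_row A" for i j
    using that herm[of i j] A by blast
  fix v :: "complex vec" assume v: "v \<in> carrier_vec (dim_row A)" "v \<noteq> 0\<^sub>v (dim_row A)"
  have "0 < Re (\<Sum>i<n. \<Sum>j<n. cnj (v $ i) * A $$ (i,j) * v $ j)"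
  proof (rule sylvester_criterion)
    show "0 < Determinant.det (mat k k (\<lambda>(i,j). A $$ (i,j)))" if "k \<le> n" for k
      using that minors by (cases k) (auto simp: det_dim_zero less_complex_def)
    show "\<exists>i<n. v $ i \<noteq> 0"
      using v A by (metis carrier_matD(1) carrier_vecD eq_vecI index_zero_vec)
  qed (use herm in blast)
  also have "(\<Sum>i<n. \<Sum>j<n. cnj (v $ i) * A $$ (i,j) * v $ j) = (A *\<^sub>v v) \<bullet>c v"
    using v A by (auto simp: scalar_prod_def lessThan_atLeast0 sum_distrib_left mult_ac intro!: sum.cong)
  finally show "Re ((A *\<^sub>v v) \<bullet>c v) > 0" .
qed

text \<open>Because \<open>L\<close> is lower triangular, the leading block of \<open>L U\<close> is the product of the leading
  blocks of \<open>L\<close> and \<open>U\<close>.\<close>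

lemma leading_minor_LU:
  fixes L U :: "'a::idom mat"
  assumes L: "L \<in> carrier_mat n n" "\<And>i. i < n \<Longrightarrow> L $$ (i,i) = 1"
      "\<And>i j. i < n \<Longrightarrow> j < n \<Longrightarrow> i < j \<Longrightarrow> L $$ (i,j) = 0"
    and U: "U \<in> carrier_mat n n" "upper_triangular U"
    and k: "k \<le> n"
  shows "Determinant.det (mat k k (\<lambda>(i,j). (L * U) $$ (i,j))) = (\<Prod>j<k. U $$ (j,j))"
proof -
  let ?L = "mat k k (\<lambda>(i,j). L $$ (i,j))" and ?U = "mat k k (\<lambda>(i,j). U $$ (i,j))"
  have "mat k k (\<lambda>(i,j). (L * U) $$ (i,j)) = ?L * ?U"
  proof (rule eq_matI)
    fix i j assume "i < dim_row (?L * ?U)" "j < dim_col (?L * ?U)"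
    then have ij: "i < k" "j < k" by auto
    have "(L * U) $$ (i,j) = (\<Sum>l<n. L $$ (i,l) * U $$ (l,j))"
      using ij k L U by (auto simp: scalar_prod_def lessThan_atLeast0 intro!: sum.cong)
    also have "\<dots> = (\<Sum>l<k. L $$ (i,l) * U $$ (l,j))"
      using ij k L(3) by (intro sum.mono_neutral_right) auto
    also have "\<dots> = (?L * ?U) $$ (i,j)"
      using ij by (auto simp: scalar_prod_def lessThan_atLeast0 intro!: sum.cong)
    finally show "mat k k (\<lambda>(i,j). (L * U) $$ (i,j)) $$ (i,j) = (?L * ?U) $$ (i,j)"
      using ij by simp
  qed auto
  moreover have "Determinant.det (?L * ?U) = Determinant.det ?L * Determinant.det ?U"
    by (rule det_mult[of _ k]) auto
  moreover have "Determinant.det ?L = 1"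
  proof -
    have "Determinant.det ?L = prod_list (diag_mat ?L)"
      using L k by (intro det_lower_triangular[of k]) auto
    also have "diag_mat ?L = map (\<lambda>_. 1) [0..<k]"
      using L k by (auto simp: diag_mat_def)
    finally show ?thesis by (simp add: map_replicate_const)
  qed
  moreover have "Determinant.det ?U = (\<Prod>j<k. U $$ (j,j))"
  proof -
    have "Determinant.det ?U = prod_list (diag_mat ?U)"
      using U k by (intro det_upper_triangular[of _ k]) (auto simp: upper_triangular_def)
    also have "diag_mat ?U = map (\<lambda>j. U $$ (j,j)) [0..<k]"
      by (auto simp: diag_mat_def)
    finally show ?thesis
      using prod.distinct_set_conv_list[of "[0..<k]" "\<lambda>j. U $$ (j,j)"]
      by (simp add: lessThan_atLeast0)
  qed
  ultimately show ?thesis by simp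
qed

text \<open>By the product formula for leading minors, \<open>\<xi> \<zeta>\<^sub>i(\<xi>)\<close> is a leading minor of the polynomial matrix,
  hence itself a polynomial. After multiplication by \<open>(1 + \<xi>)\<^sup>l\<close> it is \<open>\<xi>\<close> times a nonzero polynomial
  with nonnegative coefficients, which is positive at every \<open>\<xi> > 0\<close>. The identity is derived between
  polynomials and evaluated only afterwards, so the possible poles of \<open>L\<close> and \<open>U\<close> never enter.\<close>

lemma leading_minor_pos:
  fixes \<xi> :: real
  assumes LU: "formal_LU A L U" and A: "A \<in> carrier_mat n n" and i: "i < n"
    and nz: "zeta U i \<noteq> 0"
    and nn: "no_negative_coeffs (to_fract [:1, 1:] ^ l * zeta U i)"
    and \<xi>: "\<xi> > 0"
  shows "0 < Determinant.det (mat (Suc i) (Suc i) (\<lambda>(a,b). poly (A $$ (a,b)) (of_real \<xi>)))"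
proof -
  let ?k = "Suc i"
  let ?P = "mat ?k ?k (\<lambda>(a,b). A $$ (a,b))"
  have hom_fract: "comm_ring_hom (to_fract :: complex poly \<Rightarrow> _)"
    by unfold_locales auto
  have hom_eval: "comm_ring_hom (\<lambda>p. poly p (complex_of_real \<xi>))"
    by unfold_locales auto
  have eq: "map_mat to_fract A = L * U"
    and L: "L \<in> carrier_mat n n" "\<And>i. i < n \<Longrightarrow> L $$ (i,i) = 1"
      "\<And>i j. i < n \<Longrightarrow> j < n \<Longrightarrow> i < j \<Longrightarrow> L $$ (i,j) = 0"
    and U: "U \<in> carrier_mat n n" "upper_triangular U"
    using LU A unfolding formal_LU_def Let_def by auto
  have "map_mat to_fract ?P = mat ?k ?k (\<lambda>(i,j). (L * U) $$ (i,j))"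
    using i A by (auto simp flip: eq)
  then have "to_fract (Determinant.det ?P) = (\<Prod>j<?k. U $$ (j,j))"
    using leading_minor_LU[OF L U, of ?k] i comm_ring_hom.hom_det[OF hom_fract, of ?P] by simp
  then have prodU: "to_fract (Determinant.det ?P) = to_fract [:0, 1:] * zeta U i"
    by (simp add: zeta_def lessThan_Suc_atMost)
  obtain q where q: "to_fract [:1, 1:] ^ l * zeta U i = to_fract q" "\<And>k. 0 \<le> coeff q k"
    using nn unfolding no_negative_coeffs_def by auto
  have pow: "to_fract (([:1, 1:] :: complex poly) ^ l) = to_fract [:1, 1:] ^ l"
    by (induction l) (simp_all only: power_0 power_Suc to_fract_1 to_fract_mult)
  have "to_fract ([:1, 1:] ^ l * Determinant.det ?P) = to_fract ([:0, 1:] * q)"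
    using q(1) prodU by (simp only: to_fract_mult pow mult.left_commute)
  then have "[:1, 1:] ^ l * Determinant.det ?P = [:0, 1:] * q"
    by (simp only: to_fract_eq_iff)
  then have "poly ([:1, 1:] ^ l * Determinant.det ?P) (of_real \<xi>) = poly ([:0, 1:] * q) (of_real \<xi>)"
    by simp
  then have id: "of_real ((1 + \<xi>) ^ l) * poly (Determinant.det ?P) (of_real \<xi>)
      = of_real \<xi> * poly q (of_real \<xi>)"
    by simp
  have "to_fract q \<noteq> 0"
    using nz by (simp flip: q(1))
  then have q0: "q \<noteq> 0" by auto
  define P where "P = (\<Sum>k\<le>degree q. Re (coeff q k) * \<xi> ^ k)"
  have coeff: "coeff q k = of_real (Re (coeff q k))" "0 \<le> Re (coeff q k)" for k
    using q(2)[of k] by (auto simp: less_eq_complex_def complex_eq_iff)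
  have "0 < Re (coeff q (degree q)) * \<xi> ^ degree q"
    using q0 \<xi> coeff[of "degree q"] by (metis leading_coeff_0_iff mult_pos_pos of_real_0 order_less_le zero_less_power)
  also have "\<dots> \<le> P"
    unfolding P_def using coeff(2) \<xi> by (intro member_le_sum) auto
  finally have P: "0 < P" .
  have "poly q (of_real \<xi>) = (\<Sum>k\<le>degree q. of_real (Re (coeff q k)) * of_real \<xi> ^ k)"
    unfolding poly_altdef by (simp only: coeff(1)[symmetric])
  then have qP: "poly q (of_real \<xi>) = of_real P"
    by (simp add: P_def)
  have nz: "complex_of_real ((1 + \<xi>) ^ l) \<noteq> 0"
    unfolding of_real_eq_0_iff using \<xi> by simp
  have "poly (Determinant.det ?P) (of_real \<xi>) = of_real (\<xi> * P / (1 + \<xi>) ^ l)"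
    using id unfolding qP of_real_divide of_real_mult nonzero_eq_divide_eq[OF nz]
    by (simp only: mult.commute)
  moreover have "0 < \<xi> * P / (1 + \<xi>) ^ l"
    using P \<xi> by simp
  ultimately have "0 < poly (Determinant.det ?P) (of_real \<xi>)"
    by (simp only: less_complex_def) simp
  also have "\<dots> = Determinant.det (map_mat (\<lambda>p. poly p (of_real \<xi>)) ?P)"
    using comm_ring_hom.hom_det[OF hom_eval, of ?P] by simp
  also have "map_mat (\<lambda>p. poly p (of_real \<xi>)) ?P
      = mat ?k ?k (\<lambda>(a,b). poly (A $$ (a,b)) (of_real \<xi>))"
    by auto
  finally show ?thesis .
qed

section \<open>The matrix \<open>\<Omega>\<close> as a difference of Gram matrices\<close>

lemma Omega_at_carrier:
  assumes "M \<in> carrier_mat n n" "\<Gamma> \<in> carrier_mat n n"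
  shows "Omega_poly \<nu> \<eta> M \<Gamma> \<in> carrier_mat n n"
    "Omega_at \<nu> \<eta> M \<Gamma> \<xi> \<in> carrier_mat n n"
  using assms by (auto simp: Omega_at_def Omega_poly_def Let_def)

text \<open>The origin of \<open>\<Omega>\<close>: it is the gap between the two Gram matrices in the norm estimate, taken on the
  lower boundary ray \<open>z = - \<xi> (1 + \<i> \<eta>)\<close> of the sector. The skew part of \<open>\<Gamma>\<close> carries the factor \<open>\<i> \<eta>\<close>
  because \<open>\<xi> \<eta>\<close> is the size of the imaginary part of \<open>z\<close>, and \<open>\<bar>z\<bar>\<^sup>2 = \<xi>\<^sup>2 (1 + \<eta>\<^sup>2)\<close>.\<close>

lemma Omega_at_eq_difference:
  fixes M \<Gamma> :: "real mat" and \<nu> \<eta> \<xi> :: real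
  assumes M: "M \<in> carrier_mat n n" and \<Gamma>: "\<Gamma> \<in> carrier_mat n n"
  defines "z \<equiv> Complex (- \<xi>) (- \<eta> * \<xi>)"
  defines "N \<equiv> 1\<^sub>m n - z \<cdot>\<^sub>m cmat \<Gamma>"
  shows "Omega_at \<nu> \<eta> M \<Gamma> \<xi> =
     N * adjoint_mat N - of_real ((cmod (1 - of_real \<nu> * z))\<^sup>2) \<cdot>\<^sub>m (cmat M * adjoint_mat (cmat M))"
proof (rule eq_matI)
  fix i j assume "i < dim_row (N * adjoint_mat N - of_real ((cmod (1 - of_real \<nu> * z))\<^sup>2) \<cdot>\<^sub>m (cmat M * adjoint_mat (cmat M)))"
    "j < dim_col (N * adjoint_mat N - of_real ((cmod (1 - of_real \<nu> * z))\<^sup>2) \<cdot>\<^sub>m (cmat M * adjoint_mat (cmat M)))"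
  then have ij: "i < n" "j < n" using M by auto
  define m where "m = (\<Sum>k<n. M $$ (i,k) * M $$ (j,k))"
  define g where "g = (\<Sum>k<n. \<Gamma> $$ (i,k) * \<Gamma> $$ (j,k))"
  define \<delta> where "\<delta> = (if i = j then 1 else 0 :: complex)"
  have MM: "(M * transpose_mat M) $$ (i,j) = m" and GG: "(\<Gamma> * transpose_mat \<Gamma>) $$ (i,j) = g"
    using ij M \<Gamma> by (auto simp: scalar_prod_def lessThan_atLeast0 m_def g_def intro!: sum.cong)
  have MMc: "(cmat M * adjoint_mat (cmat M)) $$ (i,j) = of_real m"
    using ij M by (auto simp: scalar_prod_def lessThan_atLeast0 m_def intro!: sum.cong)
  have "(N * adjoint_mat N) $$ (i,j) =
     (\<Sum>k<n. ((if i = k then 1 else 0) - z * \<Gamma> $$ (i,k)) * cnj ((if j = k then 1 else 0) - z * \<Gamma> $$ (j,k)))"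
    using ij \<Gamma> by (auto simp: N_def scalar_prod_def lessThan_atLeast0 intro!: sum.cong)
  also have "\<dots> = (\<Sum>k<n. (if i = k then (if j = i then 1 else 0) else 0)
      - (if i = k then cnj z * \<Gamma> $$ (j,k) else 0) - (if j = k then z * \<Gamma> $$ (i,k) else 0)
      + z * cnj z * of_real (\<Gamma> $$ (i,k) * \<Gamma> $$ (j,k)))"
    by (intro sum.cong) (auto simp: algebra_simps)
  also have "\<dots> = \<delta> - cnj z * \<Gamma> $$ (j,i) - z * \<Gamma> $$ (i,j) + z * cnj z * of_real g"
    using ij by (simp add: sum.distrib sum_subtractf \<delta>_def g_def sum_distrib_left)
  finally have NN: "(N * adjoint_mat N) $$ (i,j) =
      \<delta> - cnj z * \<Gamma> $$ (j,i) - z * \<Gamma> $$ (i,j) + z * cnj z * of_real g" .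
  have lhs: "Omega_at \<nu> \<eta> M \<Gamma> \<xi> $$ (i,j) =
      (\<delta> - of_real m)
      + 2 * ((1/2) * (\<Gamma> $$ (i,j) + \<Gamma> $$ (j,i)) + \<i> * \<eta> * ((1/2) * (\<Gamma> $$ (i,j) - \<Gamma> $$ (j,i))) - \<nu> * m) * \<xi>
      + (1 + \<eta>\<^sup>2) * (g - \<nu>\<^sup>2 * m) * \<xi>\<^sup>2"
    using ij M \<Gamma> MM GG
    by (auto simp: Omega_at_def Omega_poly_def Let_def poly_monom sym_part_def skew_part_def \<delta>_def
        simp del: index_mult_mat(1))
  have sq: "(cmod (1 - of_real \<nu> * z))\<^sup>2 = (1 + \<nu> * \<xi>)\<^sup>2 + (\<nu> * \<eta> * \<xi>)\<^sup>2"
  proof -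
    have "1 - of_real \<nu> * z = Complex (1 + \<nu> * \<xi>) (\<nu> * \<eta> * \<xi>)"
      by (simp add: z_def complex_eq_iff)
    then show ?thesis by (simp add: cmod_power2)
  qed
  have zc: "z = - of_real \<xi> - \<i> * of_real (\<eta> * \<xi>)"
    by (simp add: z_def complex_eq_iff)
  show "Omega_at \<nu> \<eta> M \<Gamma> \<xi> $$ (i,j) = (N * adjoint_mat N
     - of_real ((cmod (1 - of_real \<nu> * z))\<^sup>2) \<cdot>\<^sub>m (cmat M * adjoint_mat (cmat M))) $$ (i,j)"
  proof -
    have "(N * adjoint_mat N
     - of_real ((cmod (1 - of_real \<nu> * z))\<^sup>2) \<cdot>\<^sub>m (cmat M * adjoint_mat (cmat M))) $$ (i,j)
     = (N * adjoint_mat N) $$ (i,j) - of_real ((cmod (1 - of_real \<nu> * z))\<^sup>2) * (cmat M * adjoint_mat (cmat M)) $$ (i,j)"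
      using ij M by (auto simp del: index_mult_mat(1))
    then show ?thesis
      unfolding NN MMc lhs sq unfolding zc 
      by (simp add: complex_eq_iff power2_eq_square algebra_simps)
  qed
qed (use M \<Gamma> in \<open>auto simp: Omega_at_def Omega_poly_def Let_def\<close>)

lemma Omega_at_hermitian:
  assumes M: "M \<in> carrier_mat n n" and \<Gamma>: "\<Gamma> \<in> carrier_mat n n" and ij: "i < n" "j < n"
  shows "Omega_at \<nu> \<eta> M \<Gamma> \<xi> $$ (i,j) = cnj (Omega_at \<nu> \<eta> M \<Gamma> \<xi> $$ (j,i))"
proof -
  have gram: "(X * adjoint_mat X) $$ (i,j) = cnj ((X * adjoint_mat X) $$ (j,i))"
    if "X \<in> carrier_mat n n" for X
    using that ij by (auto simp: scalar_prod_def mult.commute intro!: sum.cong)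
  have N: "1\<^sub>m n - z \<cdot>\<^sub>m cmat \<Gamma> \<in> carrier_mat n n" for z
    using \<Gamma> by (auto intro!: minus_carrier_mat)
  have entry: "(X * adjoint_mat X - of_real a \<cdot>\<^sub>m (Y * adjoint_mat Y)) $$ (k,l)
      = (X * adjoint_mat X) $$ (k,l) - of_real a * (Y * adjoint_mat Y) $$ (k,l)"
    if "X \<in> carrier_mat n n" "Y \<in> carrier_mat n n" "k < n" "l < n" for X Y k l and a :: real
    using that by (auto simp del: index_mult_mat(1))
  have cM: "cmat M \<in> carrier_mat n n" using M by simp
  show ?thesis
    unfolding Omega_at_eq_difference[OF M \<Gamma>] entry[OF N cM ij] entry[OF N cM ij(2,1)]
      complex_cnj_diff complex_cnj_mult complex_cnj_complex_of_real
      gram[OF N, symmetric] gram[OF cM, symmetric] ..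
qed

lemma Omega_at_quadratic_form:
  fixes M \<Gamma> :: "real mat" and \<nu> \<eta> \<xi> :: real
  assumes M: "M \<in> carrier_mat n n" and \<Gamma>: "\<Gamma> \<in> carrier_mat n n" and p: "p \<in> carrier_vec n"
  defines "z \<equiv> Complex (- \<xi>) (- \<eta> * \<xi>)"
  shows "Re ((Omega_at \<nu> \<eta> M \<Gamma> \<xi> *\<^sub>v p) \<bullet>c p) =
     (vnorm2 (adjoint_mat (1\<^sub>m n - z \<cdot>\<^sub>m cmat \<Gamma>) *\<^sub>v p))\<^sup>2
     - (cmod (1 - of_real \<nu> * z) * vnorm2 (adjoint_mat (cmat M) *\<^sub>v p))\<^sup>2"
proof -
  let ?N = "1\<^sub>m n - z \<cdot>\<^sub>m cmat \<Gamma>" and ?M = "cmat M" and ?a = "(cmod (1 - of_real \<nu> * z))\<^sup>2"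
  have gram: "Re (((X * adjoint_mat X) *\<^sub>v p) \<bullet>c p) = (vnorm2 (adjoint_mat X *\<^sub>v p))\<^sup>2"
    if X: "X \<in> carrier_mat n n" for X
  proof -
    have "((X * adjoint_mat X) *\<^sub>v p) \<bullet>c p = (X *\<^sub>v (adjoint_mat X *\<^sub>v p)) \<bullet>c p"
      using X p by (subst assoc_mult_mat_vec[of _ n n _ n]) auto
    also have "\<dots> = (adjoint_mat X *\<^sub>v p) \<bullet>c (adjoint_mat X *\<^sub>v p)"
      using X p by (intro cscalar_prod_mult_mat_vec[of _ n n]) auto
    also have "\<dots> = of_real ((vnorm2 (adjoint_mat X *\<^sub>v p))\<^sup>2)"
      by (rule vnorm2_sq_complex[symmetric])
    finally show ?thesis by simp
  qed
  have N: "?N \<in> carrier_mat n n" using \<Gamma> by (auto intro!: minus_carrier_mat)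
  have smult: "(k \<cdot>\<^sub>m X) *\<^sub>v p = k \<cdot>\<^sub>v (X *\<^sub>v p)" if "X \<in> carrier_mat n n" for k X
    using that p by (intro eq_vecI) (auto simp: scalar_prod_def sum_distrib_left mult.assoc)
  have "Omega_at \<nu> \<eta> M \<Gamma> \<xi> *\<^sub>v p =
     (?N * adjoint_mat ?N) *\<^sub>v p - of_real ?a \<cdot>\<^sub>v ((?M * adjoint_mat ?M) *\<^sub>v p)"
    unfolding z_def Omega_at_eq_difference[OF M \<Gamma>] using N M p
    by (subst minus_mult_distrib_mat_vec[of _ n n]) (auto simp: z_def smult)
  also have "\<dots> \<bullet>c p = ((?N * adjoint_mat ?N) *\<^sub>v p) \<bullet>c p - of_real ?a * (((?M * adjoint_mat ?M) *\<^sub>v p) \<bullet>c p)"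
    using N M p by (subst minus_scalar_prod_distrib[of _ n]) (auto intro!: carrier_vecI)
  finally have "Re ((Omega_at \<nu> \<eta> M \<Gamma> \<xi> *\<^sub>v p) \<bullet>c p) =
      Re (((?N * adjoint_mat ?N) *\<^sub>v p) \<bullet>c p) - ?a * Re (((?M * adjoint_mat ?M) *\<^sub>v p) \<bullet>c p)"
    by (simp del: of_real_power)
  then show ?thesis
    using gram[OF N] gram[of ?M] M by (simp add: power_mult_distrib)
qed

section \<open>The bound on the boundary rays\<close>

text \<open>Duality: \<open>T = N\<^sup>-\<^sup>1 M\<close> and its adjoint have the same norm, and for the adjoint the estimate is an
  inequality between quadratic forms that contains no inverse. The conclusion is stated
  sesquilinearly, since the maximum principle will be applied to scalar functions.\<close>

lemma contraction_of_adjoint_bound: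
  assumes N: "N \<in> carrier_mat n n" "N' \<in> carrier_mat n n" "N' * N = 1\<^sub>m n"
    and T: "T \<in> carrier_mat n n" "N * T = M" and M: "M \<in> carrier_mat n n"
    and bound: "\<And>p. p \<in> carrier_vec n \<Longrightarrow>
        a * vnorm2 (adjoint_mat M *\<^sub>v p) \<le> vnorm2 (adjoint_mat N *\<^sub>v p)"
    and a: "a \<ge> 0"
    and v: "v \<in> carrier_vec n" and u: "u \<in> carrier_vec n"
  shows "a * cmod ((T *\<^sub>v v) \<bullet>c u) \<le> vnorm2 v * vnorm2 u"
proof -
  \<comment> \<open>chosen so that the adjoint of \<open>N\<close> maps \<open>p\<close> to \<open>u\<close>\<close>
  define p where "p = adjoint_mat N' *\<^sub>v u"
  have p: "p \<in> carrier_vec n" using N u by (auto simp: p_def intro!: carrier_vecI)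
  have "adjoint_mat N *\<^sub>v p = (adjoint_mat N * adjoint_mat N') *\<^sub>v u"
    unfolding p_def using N u by (subst assoc_mult_mat_vec[of _ n n _ n]) auto
  also have "adjoint_mat N * adjoint_mat N' = adjoint_mat (N' * N)"
    using N by (subst adjoint_mat_mult) auto
  also have "\<dots> = 1\<^sub>m n"
    unfolding N(3) by (intro eq_matI) auto
  finally have Np: "adjoint_mat N *\<^sub>v p = u" using u by simp
  have "(T *\<^sub>v v) \<bullet>c u = (N *\<^sub>v (T *\<^sub>v v)) \<bullet>c p"
    using N T v p by (subst cscalar_prod_mult_mat_vec[of N n n]) (auto simp: Np intro!: carrier_vecI)
  also have "N *\<^sub>v (T *\<^sub>v v) = M *\<^sub>v v"
    using N T v by (metis assoc_mult_mat_vec)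
  also have "(M *\<^sub>v v) \<bullet>c p = v \<bullet>c (adjoint_mat M *\<^sub>v p)"
    using M v p by (rule cscalar_prod_mult_mat_vec)
  finally have "a * cmod ((T *\<^sub>v v) \<bullet>c u) \<le> a * (vnorm2 v * vnorm2 (adjoint_mat M *\<^sub>v p))"
    using a v M by (auto intro!: mult_left_mono cmod_cscalar_prod_le)
  also have "\<dots> = vnorm2 v * (a * vnorm2 (adjoint_mat M *\<^sub>v p))" by simp
  also have "\<dots> \<le> vnorm2 v * vnorm2 u"
    using bound[OF p] Np by (auto intro!: mult_left_mono vnorm2_nonneg)
  finally show ?thesis .
qed

text \<open>For real \<open>M\<close> and \<open>\<Gamma>\<close>, complex conjugation turns the estimate at \<open>z\<close> for the vector \<open>conjugate p\<close>
  into the one at \<open>cnj z\<close> for \<open>p\<close>. This transfers the bound from the lower to the upper boundary ray.\<close>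

lemma adjoint_bound_conjugate:
  fixes M \<Gamma> :: "real mat"
  assumes M: "M \<in> carrier_mat n n" and \<Gamma>: "\<Gamma> \<in> carrier_mat n n"
    and bound: "\<And>p. p \<in> carrier_vec n \<Longrightarrow> cmod (1 - of_real \<nu> * z) * vnorm2 (adjoint_mat (cmat M) *\<^sub>v p)
        \<le> vnorm2 (adjoint_mat (1\<^sub>m n - z \<cdot>\<^sub>m cmat \<Gamma>) *\<^sub>v p)"
    and p: "p \<in> carrier_vec n"
  shows "cmod (1 - of_real \<nu> * cnj z) * vnorm2 (adjoint_mat (cmat M) *\<^sub>v p)
        \<le> vnorm2 (adjoint_mat (1\<^sub>m n - cnj z \<cdot>\<^sub>m cmat \<Gamma>) *\<^sub>v p)"
proof -
  have "adjoint_mat (cmat M) *\<^sub>v conjugate p = conjugate (adjoint_mat (cmat M) *\<^sub>v p)"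
    using M p by (intro eq_vecI) (auto simp: scalar_prod_def)
  moreover have "adjoint_mat (1\<^sub>m n - z \<cdot>\<^sub>m cmat \<Gamma>) *\<^sub>v conjugate p
      = conjugate (adjoint_mat (1\<^sub>m n - cnj z \<cdot>\<^sub>m cmat \<Gamma>) *\<^sub>v p)"
    using \<Gamma> p by (intro eq_vecI) (auto simp: scalar_prod_def intro!: sum.cong)
  moreover have "cmod (1 - of_real \<nu> * cnj z) = cmod (1 - of_real \<nu> * z)"
    by (subst complex_mod_cnj[symmetric]) simp
  ultimately show ?thesis
    using bound[of "conjugate p"] p by (simp add: vnorm2_conjugate)
qed

text \<open>On the lower ray the difference of the squares of the two sides is the quadratic form of \<open>\<Omega>\<close>, by
  \<open>Omega_at_quadratic_form\<close>; the upper ray follows by conjugation.\<close>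

lemma boundary_ray_adjoint_bound:
  fixes M \<Gamma> :: "real mat"
  assumes M: "M \<in> carrier_mat n n" and \<Gamma>: "\<Gamma> \<in> carrier_mat n n"
    and pd: "\<And>\<xi>. \<xi> > 0 \<Longrightarrow> positive_definite (Omega_at \<nu> \<eta> M \<Gamma> \<xi>)"
    and z: "Re z < 0" "\<bar>Im z\<bar> = - \<eta> * Re z" and p: "p \<in> carrier_vec n"
  shows "cmod (1 - of_real \<nu> * z) * vnorm2 (adjoint_mat (cmat M) *\<^sub>v p)
        \<le> vnorm2 (adjoint_mat (1\<^sub>m n - z \<cdot>\<^sub>m cmat \<Gamma>) *\<^sub>v p)"
proof -
  define \<xi> where "\<xi> = - Re z"
  have \<xi>: "\<xi> > 0" using z by (simp add: \<xi>_def)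
  let ?z = "Complex (- \<xi>) (- \<eta> * \<xi>)"
  have lower: "cmod (1 - of_real \<nu> * ?z) * vnorm2 (adjoint_mat (cmat M) *\<^sub>v p)
        \<le> vnorm2 (adjoint_mat (1\<^sub>m n - ?z \<cdot>\<^sub>m cmat \<Gamma>) *\<^sub>v p)"
    if p: "p \<in> carrier_vec n" for p
  proof -
    have "0 \<le> Re ((Omega_at \<nu> \<eta> M \<Gamma> \<xi> *\<^sub>v p) \<bullet>c p)"
    proof (cases "p = 0\<^sub>v n")
      case True
      then show ?thesis using Omega_at_carrier(2)[OF M \<Gamma>, of \<nu> \<eta> \<xi>] by simp
    next
      case False
      have "dim_row (Omega_at \<nu> \<eta> M \<Gamma> \<xi>) = n"
        using Omega_at_carrier(2)[OF M \<Gamma>] by blast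
      moreover have "\<forall>v \<in> carrier_vec (dim_row (Omega_at \<nu> \<eta> M \<Gamma> \<xi>)).
          v \<noteq> 0\<^sub>v (dim_row (Omega_at \<nu> \<eta> M \<Gamma> \<xi>)) \<longrightarrow>
          0 < Re ((Omega_at \<nu> \<eta> M \<Gamma> \<xi> *\<^sub>v v) \<bullet>c v)"
        using pd[OF \<xi>] unfolding positive_definite_def by blast
      ultimately show ?thesis
        using p False by (simp add: less_imp_le)
    qed
    then show ?thesis
      unfolding Omega_at_quadratic_form[OF M \<Gamma> p] diff_ge_0_iff_ge
      by (rule power2_le_imp_le) (rule vnorm2_nonneg)
  qed
  have upper: "cmod (1 - of_real \<nu> * cnj ?z) * vnorm2 (adjoint_mat (cmat M) *\<^sub>v p)
        \<le> vnorm2 (adjoint_mat (1\<^sub>m n - cnj ?z \<cdot>\<^sub>m cmat \<Gamma>) *\<^sub>v p)"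
    using M \<Gamma> lower p by (rule adjoint_bound_conjugate)
  have "Im z = \<eta> * Re z \<or> Im z = - (\<eta> * Re z)"
    using z(2) by linarith
  then consider "z = ?z" | "z = cnj ?z"
    by (auto simp: \<xi>_def complex_eq_iff)
  then show ?thesis
  proof cases
    case 1
    show ?thesis by (subst (1 2) 1) (rule lower[OF p])
  next
    case 2
    show ?thesis by (subst (1 2) 2) (rule upper)
  qed
qed

section \<open>A maximum principle for sectors\<close>

lemma sector_Re_nonpos:
  assumes "\<bar>Im z\<bar> \<le> - \<eta> * Re z" and "\<eta> > 0"
  shows "Re z \<le> 0"
proof -
  have "0 \<le> - \<eta> * Re z"
    using abs_ge_zero assms(1) by (rule order_trans)
  then show ?thesis
    using assms(2) by (simp add: mult_le_0_iff)
qed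

text \<open>A maximum principle of Phragmen-Lindelof type. The existence of a limit at infinity makes it
  elementary: the sector can be cut off at a large radius. The limit is taken within the closed
  left half-plane, which contains the sector, because the functions to which this applies may have
  poles elsewhere.\<close>

lemma sector_maximum_modulus:
  fixes f :: "complex \<Rightarrow> complex" and l :: complex
  assumes \<eta>: "\<eta> > 0"
    and hol: "f holomorphic_on {z. Re z \<le> 0}"
    and lim: "(f \<longlongrightarrow> l) (inf at_infinity (principal {z. Re z \<le> 0}))"
    and ray: "\<And>z. Re z < 0 \<Longrightarrow> \<bar>Im z\<bar> = - \<eta> * Re z \<Longrightarrow> cmod (f z) \<le> C"
    and z: "\<bar>Im z\<bar> \<le> - \<eta> * Re z"
  shows "cmod (f z) \<le> C"
proof -
  define Q where "Q = {z. \<bar>Im z\<bar> \<le> - \<eta> * Re z}"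
  let ?H = "{z. Re z \<le> 0}"
  let ?d = "Complex (-1) (- \<eta>)"
  let ?p = "\<lambda>t::real. of_real t * ?d"
  have QH: "Q \<subseteq> ?H"
    using \<eta> by (auto simp: Q_def intro: sector_Re_nonpos)
  have cont: "continuous_on ?H f"
    using hol by (rule holomorphic_on_imp_continuous_on)
  have pray: "cmod (f (?p t)) \<le> C" if "t > 0" for t
    using that \<eta> by (intro ray) (auto simp: abs_mult)
  \<comment> \<open>The vertex and the point at infinity are the two ends of a boundary ray, so the bound
    passes to \<open>f 0\<close> and to \<open>l\<close> by taking limits along that ray.\<close>
  have f0: "cmod (f 0) \<le> C"
  proof -
    have "(?p \<longlongrightarrow> of_real 0 * ?d) (at_right 0)"
      by (intro tendsto_intros)
    then have p0: "filterlim ?p (at 0 within ?H) (at_right 0)"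
      unfolding filterlim_at
      by (auto simp: eventually_at_right_field complex_eq_iff intro!: exI[of _ 1])
    have "(f \<longlongrightarrow> f 0) (at 0 within ?H)"
      using cont by (auto simp: continuous_on)
    then have "((\<lambda>t. f (?p t)) \<longlongrightarrow> f 0) (at_right 0)"
      using p0 by (rule filterlim_compose)
    then have "((\<lambda>t. cmod (f (?p t))) \<longlongrightarrow> cmod (f 0)) (at_right 0)"
      by (rule tendsto_norm)
    then show ?thesis
      by (rule tendsto_upperbound)
        (auto simp: eventually_at_right_field intro!: exI[of _ 1] pray)
  qed
  have l: "cmod l \<le> C"
  proof -
    have "filterlim ?p at_infinity at_top"
    proof -
      have "filterlim (\<lambda>t. ?d * of_real t) at_infinity at_top"
        by (rule tendsto_mult_filterlim_at_infinity[OF tendsto_const _ filterlim_of_real_at_infinity])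
          (simp add: complex_eq_iff)
      then show ?thesis by (simp add: mult.commute)
    qed
    then have "filterlim ?p (inf at_infinity (principal ?H)) at_top"
      by (auto simp: filterlim_inf filterlim_principal
          intro: eventually_mono[OF eventually_ge_at_top[of 0]])
    then have "((\<lambda>t. f (?p t)) \<longlongrightarrow> l) at_top"
      using lim by (auto intro: filterlim_compose)
    then have "((\<lambda>t. cmod (f (?p t))) \<longlongrightarrow> cmod l) at_top"
      by (rule tendsto_norm)
    then show ?thesis
      by (rule tendsto_upperbound)
        (auto intro: eventually_mono[OF eventually_gt_at_top[of 0]] pray)
  qed
  have "cmod (f z) \<le> C + e" if e: "e > 0" for e
  proof -
    have "\<forall>\<^sub>F w in inf at_infinity (principal ?H). dist (f w) l < e"
      using lim e by (rule tendstoD)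
    then obtain R0 where R0: "\<And>w. R0 \<le> cmod w \<Longrightarrow> Re w \<le> 0 \<Longrightarrow> dist (f w) l < e"
      by (auto simp: eventually_inf_principal eventually_at_infinity)
    define R where "R = max R0 (cmod z) + 1"
    let ?T = "Q \<inter> cball 0 R"
    have clQ: "closed Q"
      unfolding Q_def by (intro closed_Collect_le continuous_intros)
    have opn: "open {w. \<bar>Im w\<bar> < - \<eta> * Re w}"
      by (intro open_Collect_less continuous_intros)
    have int: "{w. \<bar>Im w\<bar> < - \<eta> * Re w} \<inter> ball 0 R \<subseteq> interior ?T"
      using opn by (intro interior_maximal) (auto simp: Q_def)
    have clT: "closure ?T = ?T"
      using clQ by (intro closure_closed closed_Int) auto
    \<comment> \<open>The frontier of the truncated sector consists of pieces of the two rays, where \<open>C\<close> is a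
      bound, and of an arc so far out that \<open>f\<close> is \<open>e\<close>-close to \<open>l\<close>.\<close>
    show ?thesis
    proof (rule maximum_modulus_frontier[of f ?T])
      show "f holomorphic_on interior ?T"
        using hol by (rule holomorphic_on_subset) (use QH interior_subset in blast)
      show "continuous_on (closure ?T) f"
        unfolding clT using cont by (rule continuous_on_subset) (use QH in blast)
      show "bounded ?T"
        by (intro bounded_Int) auto
      show "z \<in> ?T"
        using z by (auto simp: Q_def R_def)
      fix w assume "w \<in> frontier ?T"
      then have wT: "w \<in> ?T" and wi: "w \<notin> interior ?T"
        by (auto simp: frontier_def clT)
      have wH: "Re w \<le> 0"
        using wT QH by auto
      consider "cmod w = R" | "\<bar>Im w\<bar> = - \<eta> * Re w"
      proof -
        have "w \<notin> {w. \<bar>Im w\<bar> < - \<eta> * Re w} \<inter> ball 0 R"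
          using wi int by blast
        then show thesis
          using wT that by (force simp: Q_def)
      qed
      then show "cmod (f w) \<le> C + e"
      proof cases
        case 1
        then have "dist (f w) l < e"
          using wH by (intro R0) (auto simp: R_def)
        then show ?thesis
          using l norm_triangle_sub[of "f w" l] by (simp add: dist_norm)
      next
        case 2
        show ?thesis
        proof (cases "Re w = 0")
          case True
          with 2 have "w = 0" by (simp add: complex_eq_iff)
          then show ?thesis using f0 e by simp
        next
          case False
          then show ?thesis using ray[of w] 2 wH e by simp
        qed
      qed
    qed
  qed
  then show ?thesis
    by (rule field_le_epsilon)
qed

section \<open>The resolvent in the left half-plane\<close>

lemma resolvent_invertible:
  fixes K :: "real mat"
  assumes K: "K \<in> carrier_mat n n" "\<And>i. i < n \<Longrightarrow> K $$ (i,i) > 0"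
      "\<And>i j. i < n \<Longrightarrow> j < n \<Longrightarrow> i < j \<Longrightarrow> K $$ (i,j) = 0"
    and z: "Re z \<le> 0"
  shows "Determinant.det (1\<^sub>m n - z \<cdot>\<^sub>m cmat K) \<noteq> 0"
proof -
  let ?A = "1\<^sub>m n - z \<cdot>\<^sub>m cmat K"
  have A: "?A \<in> carrier_mat n n" using K by (auto intro!: minus_carrier_mat)
  have "Determinant.det ?A = prod_list (diag_mat ?A)"
    using K by (intro det_lower_triangular[OF _ A]) auto
  moreover have "?A $$ (i,i) \<noteq> 0" if i: "i < n" for i
  proof
    assume "?A $$ (i,i) = 0"
    then have "Re (1 - z * of_real (K $$ (i,i))) = 0"
      using i K by simp
    then have "Re z * K $$ (i,i) = 1" by simp
    then show False using z K(2)[OF i] by (smt (verit) mult_nonpos_nonneg)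
  qed
  ultimately show ?thesis
    using K by (auto simp: prod_list_zero_iff diag_mat_def)
qed

text \<open>Solving \<open>(I - z K) x = b\<close> with a triangular \<open>K\<close> divides only by \<open>1 - z K\<^sub>i\<^sub>i\<close>, which has no zero in
  the closed left half-plane. The limit is claimed for \<open>z x\<^sub>i\<close> rather than \<open>x\<^sub>i\<close>, because this is what
  the next rows of the substitution use, and the factor \<open>1 - \<nu> z\<close> of the final estimate grows at
  the same rate.\<close>

lemma forward_substitution_holomorphic:
  fixes K :: "nat \<Rightarrow> nat \<Rightarrow> real" and b :: "nat \<Rightarrow> complex" and x :: "complex \<Rightarrow> nat \<Rightarrow> complex"
  assumes diag: "\<And>i. i < s \<Longrightarrow> K i i > 0"
    and eq: "\<And>z i. Re z \<le> 0 \<Longrightarrow> i < s \<Longrightarrow>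
          x z i - z * (\<Sum>j\<le>i. of_real (K i j) * x z j) = b i"
  assumes "i < s"
  shows "(\<lambda>z. x z i) holomorphic_on {z. Re z \<le> 0} \<and>
         (\<exists>l. ((\<lambda>z. z * x z i) \<longlongrightarrow> l) (inf at_infinity (principal {z. Re z \<le> 0})))"
  using \<open>i < s\<close>
proof (induction i rule: less_induct)
  case (less i)
  let ?H = "{z. Re z \<le> 0}" let ?F = "inf at_infinity (principal ?H)"
  let ?k = "complex_of_real (K i i)"
  define g where "g = (\<lambda>z. b i + (\<Sum>j<i. of_real (K i j) * (z * x z j)))"
  have k: "K i i > 0" using diag less by simp
  have nz: "1 - z * ?k \<noteq> 0" if "Re z \<le> 0" for z
  proof
    assume "1 - z * ?k = 0"
    then have "Re z * K i i = 1" by (simp add: complex_eq_iff)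
    then show False using that k by (smt (verit) mult_nonpos_nonneg)
  qed
  have x: "x z i = g z / (1 - z * ?k)" if "Re z \<le> 0" for z
  proof -
    have "x z i * (1 - z * ?k) = g z"
      using eq[OF that less.prems] 
      by (simp add: g_def lessThan_Suc_atMost[symmetric] algebra_simps sum_distrib_left)
    then show ?thesis using nz[OF that] by (simp add: eq_divide_eq)
  qed
  have hol: "(\<lambda>z. x z i) holomorphic_on ?H"
  proof (rule holomorphic_transform)
    show "(\<lambda>z. g z / (1 - z * ?k)) holomorphic_on ?H"
      unfolding g_def using less nz by (intro holomorphic_intros) auto
  qed (simp add: x)
  obtain l where l: "\<And>j. j < i \<Longrightarrow> ((\<lambda>z. z * x z j) \<longlongrightarrow> l j) ?F"
    using less by (metis order_less_trans)
  have "(g \<longlongrightarrow> b i + (\<Sum>j<i. of_real (K i j) * l j)) ?F"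
    unfolding g_def using l by (intro tendsto_intros) auto
  \<comment> \<open>\<open>z / (1 - z k) = 1 / (1 / z - k)\<close>, in a form whose limit at infinity can be read off\<close>
  moreover have "((\<lambda>z. inverse (inverse z - ?k)) \<longlongrightarrow> inverse (0 - ?k)) ?F"
    using k by (intro tendsto_intros tendsto_mono[OF inf_le1 tendsto_inverse_0]) auto
  ultimately have "((\<lambda>z. inverse (inverse z - ?k) * g z) \<longlongrightarrow>
       inverse (0 - ?k) * (b i + (\<Sum>j<i. of_real (K i j) * l j))) ?F"
    by (intro tendsto_mult)
  moreover have "\<forall>\<^sub>F z in ?F. inverse (inverse z - ?k) * g z = z * x z i"
    unfolding eventually_inf_principal
    using eventually_not_equal_at_infinity[of 0]
  proof eventually_elim
    case (elim z)
    show ?case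
    proof
      assume "z \<in> ?H"
      then have "x z i = g z / (1 - z * ?k)" "1 - z * ?k \<noteq> 0"
        using x nz by auto
      moreover have "inverse z - ?k = (1 - z * ?k) * inverse z"
        using elim by (simp add: algebra_simps)
      ultimately show "inverse (inverse z - ?k) * g z = z * x z i"
        by (simp add: divide_inverse mult_ac)
    qed
  qed
  ultimately have "((\<lambda>z. z * x z i) \<longlongrightarrow>
       inverse (0 - ?k) * (b i + (\<Sum>j<i. of_real (K i j) * l j))) ?F"
    by (rule Lim_transform_eventually)
  then show ?case
    using hol by blast
qed

text \<open>The entries of the resolvent applied to \<open>b\<close> are the unknowns of a forward substitution. They decay
  like \<open>1 / z\<close>, so that the linear factor \<open>1 - \<nu> z\<close> still leaves a limit at infinity.\<close>

lemma resolvent_form_holomorphic: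
  fixes K :: "real mat" and \<nu> :: real
  assumes K: "K \<in> carrier_mat n n" "\<And>i. i < n \<Longrightarrow> K $$ (i,i) > 0"
      "\<And>i j. i < n \<Longrightarrow> j < n \<Longrightarrow> i < j \<Longrightarrow> K $$ (i,j) = 0"
    and b: "b \<in> carrier_vec n" and u: "u \<in> carrier_vec n"
  defines "f \<equiv> \<lambda>z. (1 - of_real \<nu> * z) * ((minv (1\<^sub>m n - z \<cdot>\<^sub>m cmat K) *\<^sub>v b) \<bullet>c u)"
  shows "f holomorphic_on {z. Re z \<le> 0}"
    and "\<exists>l. (f \<longlongrightarrow> l) (inf at_infinity (principal {z. Re z \<le> 0}))"
proof -
  let ?H = "{z. Re z \<le> 0}" let ?F = "inf at_infinity (principal ?H)"
  define x where "x z i = (minv (1\<^sub>m n - z \<cdot>\<^sub>m cmat K) *\<^sub>v b) $ i" for z i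
  have A: "1\<^sub>m n - z \<cdot>\<^sub>m cmat K \<in> carrier_mat n n" for z
    using K by (auto intro!: minus_carrier_mat)
  have eq: "x z i - z * (\<Sum>j\<le>i. of_real (K $$ (i,j)) * x z j) = b $ i"
    if z: "Re z \<le> 0" and i: "i < n" for z i
  proof -
    let ?A = "1\<^sub>m n - z \<cdot>\<^sub>m cmat K"
    have m: "minv ?A \<in> carrier_mat n n" "?A * minv ?A = 1\<^sub>m n"
      using minv_right_left[OF A resolvent_invertible[OF K z]] by blast+
    have "b = (?A * minv ?A) *\<^sub>v b"
      using b unfolding m(2) by simp
    also have "\<dots> = ?A *\<^sub>v (minv ?A *\<^sub>v b)"
      using A m(1) b by (rule assoc_mult_mat_vec)
    finally have "b = ?A *\<^sub>v (minv ?A *\<^sub>v b)" .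
    then have "b $ i = (?A *\<^sub>v (minv ?A *\<^sub>v b)) $ i" by simp
    also have "\<dots> = (\<Sum>j<n. ((if i = j then 1 else 0) - z * of_real (K $$ (i,j))) * x z j)"
      using i K m by (auto simp: x_def scalar_prod_def lessThan_atLeast0 intro!: sum.cong)
    also have "\<dots> = (\<Sum>j<n. (if i = j then x z j else 0) - z * (of_real (K $$ (i,j)) * x z j))"
      by (intro sum.cong) (auto simp: algebra_simps)
    also have "\<dots> = x z i - z * (\<Sum>j<n. of_real (K $$ (i,j)) * x z j)"
      using i by (simp add: sum_subtractf sum_distrib_left)
    also have "(\<Sum>j<n. of_real (K $$ (i,j)) * x z j) = (\<Sum>j\<le>i. of_real (K $$ (i,j)) * x z j)"
      using i K(3) by (intro sum.mono_neutral_right) auto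
    finally show ?thesis by simp
  qed
  have fs: "(\<lambda>z. x z i) holomorphic_on ?H \<and> (\<exists>l. ((\<lambda>z. z * x z i) \<longlongrightarrow> l) ?F)" if "i < n" for i
    by (rule forward_substitution_holomorphic[where s = n and K = "\<lambda>i j. K $$ (i,j)" and b = "\<lambda>i. b $ i"])
      (use K(2) eq that in auto)
  have f: "f z = (\<Sum>i<n. (1 - of_real \<nu> * z) * (x z i * cnj (u $ i)))" for z
    using u by (auto simp: f_def x_def scalar_prod_def lessThan_atLeast0 sum_distrib_left)
  show "f holomorphic_on ?H"
    unfolding f using fs by (intro holomorphic_intros) auto
  obtain l where l: "\<And>i. i < n \<Longrightarrow> ((\<lambda>z. z * x z i) \<longlongrightarrow> l i) ?F"
    using fs by metis
  \<comment> \<open>\<open>(1 - \<nu> z) x\<^sub>i = (1 / z - \<nu>) (z x\<^sub>i)\<close>, which tends to \<open>- \<nu> l\<^sub>i\<close>\<close>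
  have "((\<lambda>z. \<Sum>i<n. (inverse z * (z * x z i) - of_real \<nu> * (z * x z i)) * cnj (u $ i))
      \<longlongrightarrow> (\<Sum>i<n. (0 * l i - of_real \<nu> * l i) * cnj (u $ i))) ?F"
    by (intro tendsto_intros tendsto_mono[OF inf_le1 tendsto_inverse_0] l) auto
  moreover have "\<forall>\<^sub>F z in ?F. (\<Sum>i<n. (inverse z * (z * x z i) - of_real \<nu> * (z * x z i)) * cnj (u $ i)) = f z"
    unfolding eventually_inf_principal using eventually_not_equal_at_infinity[of 0]
    by eventually_elim (auto simp: f algebra_simps intro!: sum.cong)
  ultimately show "\<exists>l. (f \<longlongrightarrow> l) ?F"
    using Lim_transform_eventually by (intro exI) 
qed

section \<open>The bound on the sector\<close>

text \<open>The bound holds on the two boundary rays by \<open>contraction_of_adjoint_bound\<close> and extends to the sector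
  by \<open>sector_maximum_modulus\<close>, applied to each scalar function
  \<open>z \<mapsto> (1 - \<nu> z) \<langle>T z v, u\<rangle>\<close>, where \<open>T z\<close> is the conjugated resolvent product.\<close>

lemma weighted_resolvent_bound:
  fixes W B K :: "real mat" and \<nu> \<eta> :: real
  assumes W: "W \<in> carrier_mat n n" "Determinant.det W \<noteq> 0"
    and B: "B \<in> carrier_mat n n"
    and K: "K \<in> carrier_mat n n" "\<And>i. i < n \<Longrightarrow> K $$ (i,i) > 0"
      "\<And>i j. i < n \<Longrightarrow> j < n \<Longrightarrow> i < j \<Longrightarrow> K $$ (i,j) = 0"
    and pd: "\<And>\<xi>. \<xi> > 0 \<Longrightarrow> positive_definite (Omega_at \<nu> \<eta> (conj_by W B) (conj_by W K) \<xi>)"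
    and \<nu>: "\<nu> \<ge> 0" and \<eta>: "\<eta> > 0"
    and z: "\<bar>Im z\<bar> \<le> - \<eta> * Re z"
  shows "weighted_norm W (minv (1\<^sub>m n - z \<cdot>\<^sub>m cmat K) * cmat B) \<le> 1 / cmod (1 - of_real \<nu> * z)"
proof -
  define V where "V = cmat (minv W)"
  define R where "R z = minv (1\<^sub>m n - z \<cdot>\<^sub>m cmat K)" for z
  define T where "T z = V * (R z * cmat B) * cmat W" for z
  define M where "M = conj_by W B"
  define \<Gamma> where "\<Gamma> = conj_by W K"
  have z0: "Re z \<le> 0" using z \<eta> by (rule sector_Re_nonpos)
  let ?N = "\<lambda>z. 1\<^sub>m n - z \<cdot>\<^sub>m cmat \<Gamma>" and ?A = "\<lambda>z. 1\<^sub>m n - z \<cdot>\<^sub>m cmat K"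
  let ?W = "cmat W" and ?B = "cmat B" and ?K = "cmat K"
  note mW = minv_right_left[OF W]
  have cW: "?W \<in> carrier_mat n n" and cV: "V \<in> carrier_mat n n" and cB: "?B \<in> carrier_mat n n"
    and cK: "?K \<in> carrier_mat n n" and cM: "M \<in> carrier_mat n n" and c\<Gamma>: "\<Gamma> \<in> carrier_mat n n"
    using W B K mW by (auto simp: V_def M_def \<Gamma>_def conj_by_def)
  have VW: "V * ?W = 1\<^sub>m n" and WV: "?W * V = 1\<^sub>m n"
    unfolding V_def by (simp_all add: mW(2,3) of_real_hom.mat_hom_one flip: of_real_hom.mat_hom_mult[OF mW(1) W(1)]
        of_real_hom.mat_hom_mult[OF W(1) mW(1)])
  have M: "cmat M = V * ?B * ?W" and \<Gamma>: "cmat \<Gamma> = V * ?K * ?W"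
    unfolding M_def \<Gamma>_def conj_by_def V_def
    by (simp_all add: of_real_hom.mat_hom_mult[OF mult_carrier_mat[OF mW(1) B] W(1)]
        of_real_hom.mat_hom_mult[OF mult_carrier_mat[OF mW(1) K(1)] W(1)]
        of_real_hom.mat_hom_mult[OF mW(1) B] of_real_hom.mat_hom_mult[OF mW(1) K(1)])
  have cA: "?A z \<in> carrier_mat n n" for z
    using cK by (auto intro!: minus_carrier_mat)
  have R: "R z \<in> carrier_mat n n" "?A z * R z = 1\<^sub>m n" "R z * ?A z = 1\<^sub>m n" if "Re z \<le> 0" for z
    unfolding R_def using minv_right_left[OF cA resolvent_invertible[OF K that]] by blast+
  have N: "?N z = V * ?A z * ?W" for z
  proof -
    have "V * ?A z = V - z \<cdot>\<^sub>m (V * ?K)"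
      using cV cK by (subst mult_minus_distrib_mat[of _ n n _ n]) auto
    then have "V * ?A z * ?W = (V - z \<cdot>\<^sub>m (V * ?K)) * ?W"
      by (simp only:)
    also have "\<dots> = V * ?W - z \<cdot>\<^sub>m (V * ?K) * ?W"
      using cV cK cW by (intro minus_mult_distrib_mat[of _ n n _ _ n]) auto
    also have "z \<cdot>\<^sub>m (V * ?K) * ?W = z \<cdot>\<^sub>m cmat \<Gamma>"
      unfolding \<Gamma> using cV cK cW by (intro mult_smult_assoc_mat[of _ n n _ n]) auto
    finally show ?thesis
      by (simp only: VW)
  qed
  have cancel: "(V * X * ?W) * (V * Y * ?W) = V * (X * Y) * ?W"
    if X: "X \<in> carrier_mat n n" and Y: "Y \<in> carrier_mat n n" for X Y
  proof -
    have "(V * X * ?W) * (V * Y * ?W) = V * X * (?W * V) * (Y * ?W)"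
      using X Y cV cW by (simp add: assoc_mult_mat[of _ n n _ n _ n])
    also have "\<dots> = V * (X * Y) * ?W"
      using X Y cV cW by (simp add: WV assoc_mult_mat[of _ n n _ n _ n])
    finally show ?thesis .
  qed
  have cT: "T z \<in> carrier_mat n n" if "Re z \<le> 0" for z
    using R(1)[OF that] cV cB cW by (auto simp: T_def)
  have NT: "?N z * T z = cmat M" if "Re z \<le> 0" for z
  proof -
    have "?N z * T z = V * (?A z * (R z * ?B)) * ?W"
      unfolding N T_def using R(1)[OF that] cB cA by (intro cancel) auto
    also have "?A z * (R z * ?B) = ?B"
      using R[OF that] cA cB by (subst assoc_mult_mat[symmetric, of _ n n _ n _ n]) auto
    finally show ?thesis using M by simp
  qed
  have RN: "(V * R z * ?W) * ?N z = 1\<^sub>m n" if "Re z \<le> 0" for z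
    unfolding N using R[OF that] cA cV VW by (subst cancel) auto
  have ray: "cmod ((1 - of_real \<nu> * z) * ((T z *\<^sub>v v) \<bullet>c u)) \<le> vnorm2 v * vnorm2 u"
    if z: "Re z < 0" "\<bar>Im z\<bar> = - \<eta> * Re z" and v: "v \<in> carrier_vec n" and u: "u \<in> carrier_vec n" for z v u
  proof -
    have z0: "Re z \<le> 0" using z by simp
    have "cmod (1 - of_real \<nu> * z) * cmod ((T z *\<^sub>v v) \<bullet>c u) \<le> vnorm2 v * vnorm2 u"
    proof (rule contraction_of_adjoint_bound[of "?N z" n "V * R z * ?W" "T z" "cmat M"])
      show "?N z \<in> carrier_mat n n" using c\<Gamma> by (auto intro!: minus_carrier_mat)
      show "V * R z * ?W \<in> carrier_mat n n" using cV R(1)[OF z0] cW by auto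
      show "cmod (1 - of_real \<nu> * z) * vnorm2 (adjoint_mat (cmat M) *\<^sub>v p)
          \<le> vnorm2 (adjoint_mat (?N z) *\<^sub>v p)" if "p \<in> carrier_vec n" for p
        using pd z that unfolding M_def[symmetric] \<Gamma>_def[symmetric]
        by (intro boundary_ray_adjoint_bound[OF cM c\<Gamma>]) auto
    qed (use RN[OF z0] cT[OF z0] NT[OF z0] cM v u in auto)
    then show ?thesis by (simp add: norm_mult)
  qed
  \<comment> \<open>The scalar function for fixed \<open>v\<close> and \<open>u\<close> is pulled back to the original basis, where \<open>K\<close>
    is triangular.\<close>
  have sector: "cmod ((1 - of_real \<nu> * z) * ((T z *\<^sub>v v) \<bullet>c u)) \<le> vnorm2 v * vnorm2 u"
    if v: "v \<in> carrier_vec n" and u: "u \<in> carrier_vec n" for v u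
  proof -
    define b where "b = ?B *\<^sub>v (?W *\<^sub>v v)"
    define u' where "u' = adjoint_mat V *\<^sub>v u"
    have b: "b \<in> carrier_vec n" and u': "u' \<in> carrier_vec n"
      using cB cV by (auto simp: b_def u'_def intro!: carrier_vecI)
    have form: "(T z *\<^sub>v v) \<bullet>c u = (R z *\<^sub>v b) \<bullet>c u'" if "Re z \<le> 0" for z
    proof -
      note Rz = R(1)[OF that]
      have "T z *\<^sub>v v = V *\<^sub>v (R z *\<^sub>v b)"
        unfolding T_def b_def using Rz cV cB cW v
        by (simp add: assoc_mult_mat_vec[of _ n n _ n] mult_mat_vec_carrier[of _ n n])
      then show ?thesis
        unfolding u'_def using Rz cV b u
        by (simp add: cscalar_prod_mult_mat_vec[of V n n] mult_mat_vec_carrier[of _ n n])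
    qed
    define f where "f z = (1 - of_real \<nu> * z) * ((R z *\<^sub>v b) \<bullet>c u')" for z
    have hol: "f holomorphic_on {z. Re z \<le> 0}"
      unfolding f_def R_def by (rule resolvent_form_holomorphic(1)[OF K b u'])
    obtain l where l: "(f \<longlongrightarrow> l) (inf at_infinity (principal {z. Re z \<le> 0}))"
      using resolvent_form_holomorphic(2)[OF K b u', of \<nu>] unfolding f_def R_def by blast
    have "cmod (f z) \<le> vnorm2 v * vnorm2 u"
    proof (rule sector_maximum_modulus[OF \<eta> hol l _ z])
      fix w assume w: "Re w < 0" "\<bar>Im w\<bar> = - \<eta> * Re w"
      then show "cmod (f w) \<le> vnorm2 v * vnorm2 u"
        using ray[OF w v u] form[of w] by (simp add: f_def)
    qed
    then show ?thesis using form[OF z0] by (simp add: f_def)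
  qed
  let ?a = "cmod (1 - of_real \<nu> * z)"
  have "1 \<le> Re (1 - of_real \<nu> * z)"
    using \<nu> z0 by (simp add: mult_nonneg_nonpos)
  also have "\<dots> \<le> ?a" by (rule complex_Re_le_cmod)
  finally have a: "?a > 0" by linarith
  have bound: "vnorm2 (T z *\<^sub>v v) \<le> 1 / ?a" if v: "v \<in> carrier_vec n" "vnorm2 v \<le> 1" for v
  proof -
    let ?y = "T z *\<^sub>v v"
    have y: "?y \<in> carrier_vec n" using cT[OF z0] by (auto intro!: carrier_vecI)
    \<comment> \<open>The sesquilinear bound is used at \<open>u = T z v\<close> for this one \<open>z\<close>. It was proved for a constant \<open>u\<close>,
      since with a \<open>u\<close> depending on \<open>z\<close> the scalar function need not be holomorphic.\<close>
    have "?a * (vnorm2 ?y)\<^sup>2 = cmod ((1 - of_real \<nu> * z) * (?y \<bullet>c ?y))"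
      unfolding vnorm2_sq_complex[symmetric] by (simp add: norm_mult norm_power vnorm2_nonneg)
    also have "\<dots> \<le> vnorm2 v * vnorm2 ?y"
      by (rule sector[OF v(1) y])
    also have "\<dots> \<le> 1 * vnorm2 ?y"
      using v(2) by (intro mult_right_mono vnorm2_nonneg)
    finally have "(?a * vnorm2 ?y) * vnorm2 ?y \<le> 1 * vnorm2 ?y"
      by (simp add: power2_eq_square)
    then have "?a * vnorm2 ?y \<le> 1"
      using vnorm2_nonneg[of ?y] a by (cases "vnorm2 ?y = 0") (auto simp: mult_le_cancel_right)
    then show ?thesis using a by (simp add: field_simps)
  qed
  have "weighted_norm W (minv (?A z) * ?B) = spectral_norm (T z)"
    unfolding weighted_norm_def T_def R_def V_def minv_cmat[OF W] ..
  also have "\<dots> \<le> 1 / ?a"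
    unfolding spectral_norm_def
  proof (rule cSUP_least)
    have "0\<^sub>v (dim_col (T z)) \<in> {v \<in> carrier_vec (dim_col (T z)). vnorm2 v \<le> 1}"
      by (simp add: vnorm2_def L2_set_def)
    then show "{v \<in> carrier_vec (dim_col (T z)). vnorm2 v \<le> 1} \<noteq> {}"
      by blast
  qed (use bound cT[OF z0] in auto)
  finally show ?thesis .
qed

theorem theorem3p1:
  fixes s r :: nat and S :: "real set" and c :: "nat \<Rightarrow> real"
    and B K :: "real \<Rightarrow> real mat" and W :: "real mat" and M_se :: "real \<Rightarrow> real mat"
    and \<nu> \<eta> :: real
    and L U :: "real \<Rightarrow> complex poly fract mat" and ell :: "real \<Rightarrow> nat \<Rightarrow> nat"
  assumes "s \<ge> 1" and "r \<ge> 2"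
    and "S \<subseteq> {0<..<2}" and "finite S \<or> (\<exists>a b. S = {a..b})"
    and "peer_coefficients s S c B K" and "LSRK s S c B"
    and "\<And>\<sigma>. \<sigma> \<in> S \<Longrightarrow> order_conditions s r c \<sigma> (B \<sigma>) (K \<sigma>)"
    and "W \<in> carrier_mat s s" and "invertible_mat W"
    and "\<And>\<sigma>. \<sigma> \<in> S \<Longrightarrow> M_se \<sigma> \<in> carrier_mat (s - 1) (s - 1)"
    and "\<And>\<sigma>. \<sigma> \<in> S \<Longrightarrow>
           conj_by W (B \<sigma>) = four_block_mat (1\<^sub>m 1) (0\<^sub>m 1 (s - 1)) (0\<^sub>m (s - 1) 1) (M_se \<sigma>)"
    and "\<And>\<sigma>. \<sigma> \<in> S \<Longrightarrow> spectral_norm (cmat (M_se \<sigma>)) < 1"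
    and "\<nu> \<ge> 0" and "ereal \<nu> < min 1 (nu_infinity W S B K)" and "\<eta> > 0"
    and "\<And>\<sigma>. \<sigma> \<in> S \<Longrightarrow>
           formal_LU (Omega_poly \<nu> \<eta> (conj_by W (B \<sigma>)) (conj_by W (K \<sigma>))) (L \<sigma>) (U \<sigma>)"
    and "\<And>\<sigma> i. \<sigma> \<in> S \<Longrightarrow> i < s \<Longrightarrow> zeta (U \<sigma>) i \<noteq> 0"
    and "\<And>\<sigma> i. \<sigma> \<in> S \<Longrightarrow> i < s \<Longrightarrow>
           no_negative_coeffs (to_fract [:1, 1:] ^ ell \<sigma> i * zeta (U \<sigma>) i)"
  shows "(\<forall>\<sigma>\<in>S. \<forall>\<xi>>0.
            positive_definite (Omega_at \<nu> \<eta> (conj_by W (B \<sigma>)) (conj_by W (K \<sigma>)) \<xi>)) \<and>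
         (\<forall>\<sigma>\<in>S. \<forall>z::complex. \<bar>Im z\<bar> \<le> - \<eta> * Re z \<longrightarrow>
            weighted_norm W (minv (1\<^sub>m s - z \<cdot>\<^sub>m cmat (K \<sigma>)) * cmat (B \<sigma>))
              \<le> 1 / cmod (1 - of_real \<nu> * z))"
proof -
  note W = \<open>W \<in> carrier_mat s s\<close>
  note LU = assms(16) and zeta_nonzero = assms(17) and zeta_coeffs = assms(18)
  note detW = det_nonzero_if_invertible_mat[OF W \<open>invertible_mat W\<close>]
  have B: "B \<sigma> \<in> carrier_mat s s" and K: "K \<sigma> \<in> carrier_mat s s"
      "\<And>i. i < s \<Longrightarrow> K \<sigma> $$ (i,i) > 0"
      "\<And>i j. i < s \<Longrightarrow> j < s \<Longrightarrow> i < j \<Longrightarrow> K \<sigma> $$ (i,j) = 0" if "\<sigma> \<in> S" for \<sigma>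
    using \<open>peer_coefficients s S c B K\<close> that by (auto simp: peer_coefficients_def)
  have conj: "conj_by W X \<in> carrier_mat s s" if "X \<in> carrier_mat s s" for X
    using that W minv_right_left(1)[OF W detW] by (auto simp: conj_by_def)
  have pd: "positive_definite (Omega_at \<nu> \<eta> (conj_by W (B \<sigma>)) (conj_by W (K \<sigma>)) \<xi>)"
    if \<sigma>: "\<sigma> \<in> S" and \<xi>: "\<xi> > 0" for \<sigma> \<xi>
  proof -
    let ?M = "conj_by W (B \<sigma>)" and ?G = "conj_by W (K \<sigma>)"
    have M: "?M \<in> carrier_mat s s" and G: "?G \<in> carrier_mat s s"
      using conj B[OF \<sigma>] K(1)[OF \<sigma>] by auto
    note poly_carrier = Omega_at_carrier(1)[OF M G, of \<nu> \<eta>]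
    show ?thesis
    proof (rule positive_definite_sylvester)
      show "Omega_at \<nu> \<eta> ?M ?G \<xi> \<in> carrier_mat s s"
        by (rule Omega_at_carrier(2)[OF M G])
      show "Omega_at \<nu> \<eta> ?M ?G \<xi> $$ (i,j) = cnj (Omega_at \<nu> \<eta> ?M ?G \<xi> $$ (j,i))"
        if "i < s" "j < s" for i j
        by (rule Omega_at_hermitian[OF M G that])
      fix k assume k: "k < s"
      have "0 < Determinant.det (mat (Suc k) (Suc k)
          (\<lambda>(a,b). poly (Omega_poly \<nu> \<eta> ?M ?G $$ (a,b)) (of_real \<xi>)))"
        using LU[OF \<sigma>] poly_carrier k zeta_nonzero[OF \<sigma> k] zeta_coeffs[OF \<sigma> k] \<xi>
        by (rule leading_minor_pos)
      also have "mat (Suc k) (Suc k) (\<lambda>(a,b). poly (Omega_poly \<nu> \<eta> ?M ?G $$ (a,b)) (of_real \<xi>))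
          = mat (Suc k) (Suc k) (\<lambda>(i,j). Omega_at \<nu> \<eta> ?M ?G \<xi> $$ (i,j))"
        using k poly_carrier by (intro eq_matI) (auto simp: Omega_at_def)
      finally show "0 < Determinant.det (mat (Suc k) (Suc k) (\<lambda>(i,j). Omega_at \<nu> \<eta> ?M ?G \<xi> $$ (i,j)))" .
    qed
  qed
  show ?thesis
  proof (intro conjI ballI allI impI)
    fix \<sigma> z assume \<sigma>: "\<sigma> \<in> S" and z: "\<bar>Im z\<bar> \<le> - \<eta> * Re z"
    show "weighted_norm W (minv (1\<^sub>m s - z \<cdot>\<^sub>m cmat (K \<sigma>)) * cmat (B \<sigma>))
              \<le> 1 / cmod (1 - of_real \<nu> * z)"
    proof (rule weighted_resolvent_bound[OF W detW B[OF \<sigma>] K(1)[OF \<sigma>]])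
      show "positive_definite (Omega_at \<nu> \<eta> (conj_by W (B \<sigma>)) (conj_by W (K \<sigma>)) \<xi>)" if "\<xi> > 0" for \<xi>
        using \<sigma> that by (rule pd)
    qed (use K(2,3)[OF \<sigma>] \<open>\<nu> \<ge> 0\<close> \<open>\<eta> > 0\<close> z in auto)
  qed (rule pd)
qed

end
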